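(* Let $q\ge 1$ be an integer, let $\alpha\ge 0$, $\beta\ge 0$, $2\le p<\infty$, and let $w:\mathbb{C}^+\to(0,\infty)$ be a weight for which there exist a constant $C>0$, a non-negative integer $k$ and $r_0\in(0,1)$ such that $$r^k\,w\left(\frac{z}{r}\right)\le C\,w(z)\quad\text{for all } z\in\mathbb{C}^+ \text{ and all } r_0\le r<1.$$ Then for each $f\in\mathcal{B}^p_{q,w}(\mathbb{C}^+)$ the dilatations $f_r(z)=f(rz)$, $0<r<1$, converge to $f$ in norm, i.e. $$\lim_{r\to1^-}\|f_r-f\|_{\mathcal{B}^p_{q,w}(\mathbb{C}^+)}=0.$$
   Context: $\mathbb{C}^+=\{z\in\mathbb{C}:\operatorname{Im}(z)>0\}$ and $dA$ is area measure. For $z=x+iy$, $\partial_z f=\frac12\left(\frac{\partial f}{\partial x}-i\frac{\partial f}{\partial y}\right)$ and $\partial_{\overline z} f=\frac12\left(\frac{\partial f}{\partial x}+i\frac{\partial f}{\partial y}\right)$. A function $f:\mathbb{C}^+\to\mathbb{C}$ is $q$-analytic if $f\in C^q(\mathbb{C}^+)$ and $\left(\partial_{\overline z}\right)^q f=0$ on $\mathbb{C}^+$. A weight on $\mathbb{C}^+$ is a positive function that is integrable on $\mathbb{C}^+$ with respect to $dA$. The weighted polyanalytic Besov space $\mathcal{B}^p_{q,w}(\mathbb{C}^+)$ (with fixed parameters $\alpha,\beta$) is the set of $q$-analytic functions $f$ on $\mathbb{C}^+$ for which $$\|f\|^p_{\mathcal{B}^p_{q,w}(\mathbb{C}^+)}=|f(i)|^p+\int_{\mathbb{C}^+}\left[|\partial_z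 f(z)|^p+|\partial_{\overline z}f(z)|^p\right]w(z)\,\operatorname{Im}(z)^{\alpha+p-2}e^{-\beta|z|^2}\,dA(z)<\infty.$$ *)

theory Defs
  imports "HOL-Analysis.Analysis"
begin

definition upper_half_plane :: "complex set" where
  "upper_half_plane = {z. Im z > 0}"

(* Functions on the upper half-plane are represented by total functions on complex of which
   only the values on the half-plane matter: it is open, so the pointwise derivatives
   below do not see the values outside it. *)

definition partial_x :: "(complex \<Rightarrow> complex) \<Rightarrow> complex \<Rightarrow> complex" where
  "partial_x f z = vector_derivative (\<lambda>t. f (Complex t (Im z))) (at (Re z))"

definition partial_y :: "(complex \<Rightarrow> complex) \<Rightarrow> complex \<Rightarrow> complex" where
  "partial_y f z = vector_derivative (\<lambda>t. f (Complex (Re z) t)) (at (Im z))"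

(* C^n on S (intended for open S): all partial derivatives of order at most n exist
   and are continuous on S. *)
primrec Cn_on :: "nat \<Rightarrow> complex set \<Rightarrow> (complex \<Rightarrow> complex) \<Rightarrow> bool" where
  "Cn_on 0 S f \<longleftrightarrow> continuous_on S f"
| "Cn_on (Suc n) S f \<longleftrightarrow>
     continuous_on S f \<and>
     (\<forall>z\<in>S. (\<lambda>t. f (Complex t (Im z))) differentiable (at (Re z)) \<and>
            (\<lambda>t. f (Complex (Re z) t)) differentiable (at (Im z))) \<and>
     Cn_on n S (partial_x f) \<and> Cn_on n S (partial_y f)"

definition d_z :: "(complex \<Rightarrow> complex) \<Rightarrow> complex \<Rightarrow> complex" where
  "d_z f z = (partial_x f z - \<i> * partial_y f z) / 2"

definition d_zbar :: "(complex \<Rightarrow> complex) \<Rightarrow> complex \<Rightarrow> complex" where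
  "d_zbar f z = (partial_x f z + \<i> * partial_y f z) / 2"

definition q_analytic :: "nat \<Rightarrow> (complex \<Rightarrow> complex) \<Rightarrow> bool" where
  "q_analytic q f \<longleftrightarrow>
     Cn_on q upper_half_plane f \<and> (\<forall>z\<in>upper_half_plane. (d_zbar ^^ q) f z = 0)"

definition is_weight :: "(complex \<Rightarrow> real) \<Rightarrow> bool" where
  "is_weight w \<longleftrightarrow>
     (\<forall>z\<in>upper_half_plane. w z > 0) \<and> set_integrable lebesgue upper_half_plane w"

(* The p-th power of the Besov norm, with value infinity if the integral diverges. *)
definition besov_norm_pow ::
  "real \<Rightarrow> real \<Rightarrow> real \<Rightarrow> (complex \<Rightarrow> real) \<Rightarrow> (complex \<Rightarrow> complex) \<Rightarrow> ennreal" where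
  "besov_norm_pow \<alpha> \<beta> p w f =
     ennreal (cmod (f \<i>) powr p) +
     (\<integral>\<^sup>+z\<in>upper_half_plane.
        ennreal ((cmod (d_z f z) powr p + cmod (d_zbar f z) powr p)
                 * w z * Im z powr (\<alpha> + p - 2) * exp (- \<beta> * (cmod z)\<^sup>2)) \<partial>lebesgue)"

definition besov_norm ::
  "real \<Rightarrow> real \<Rightarrow> real \<Rightarrow> (complex \<Rightarrow> real) \<Rightarrow> (complex \<Rightarrow> complex) \<Rightarrow> ennreal" where
  "besov_norm \<alpha> \<beta> p w f =
     (if besov_norm_pow \<alpha> \<beta> p w f = \<infinity> then \<infinity>
      else ennreal (enn2real (besov_norm_pow \<alpha> \<beta> p w f) powr (1 / p)))"

definition besov_space ::
  "nat \<Rightarrow> real \<Rightarrow> real \<Rightarrow> real \<Rightarrow> (complex \<Rightarrow> real) \<Rightarrow> (complex \<Rightarrow> complex) set" where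
  "besov_space q \<alpha> \<beta> p w = {f. q_analytic q f \<and> besov_norm_pow \<alpha> \<beta> p w f < \<infinity>}"

definition dilatation :: "real \<Rightarrow> (complex \<Rightarrow> complex) \<Rightarrow> complex \<Rightarrow> complex" where
  "dilatation r f z = f (of_real r * z)"

end

theory Submission
  imports Defs
begin

text \<open>
  The dilatation difference has Wirtinger derivatives of the form
  \<open>r * g (r z) - g z\<close>, where \<open>g\<close> is \<open>d_z f\<close> or \<open>d_zbar f\<close>.
  So everything reduces to one statement about a single continuous function \<open>g\<close> in a
  weighted \<open>L\<^sup>p\<close> space: \<open>r * g (r z)\<close> tends to \<open>g z\<close> in that space
  (\<open>nn_integral_dilation_diff_tendsto_0\<close>).

  The total weight is \<open>W z = w z * Im z powr (\<alpha> + p - 2) * exp (- \<beta> * (cmod z)\<^sup>2)\<close>.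
  The hypothesis on \<open>w\<close>, read at the point \<open>r z\<close>, bounds \<open>w z\<close> by a multiple of
  \<open>w (r z)\<close>. The power of \<open>Im z\<close> loses only a bounded factor, and the Gaussian does not decrease when
  \<open>z\<close> is contracted to \<open>r z\<close>. Hence \<open>W z \<le> M * W (r z)\<close> with \<open>M\<close> independent of \<open>r\<close>
  (\<open>besov_weight_dilation_bound\<close>), and after the substitution \<open>u = r z\<close> the dilatations are
  bounded uniformly in \<open>r\<close>.

  There need be no pointwise convergence of \<open>w (u / r)\<close>, so dominated convergence is not
  available on the whole half-plane. Instead the half-plane is exhausted by the compact
  sets \<open>{z. 1 / R \<le> Im z \<and> cmod z \<le> R}\<close>. On such a set \<open>r * g (r z)\<close> converges to \<open>g z\<close>
  uniformly and \<open>W\<close> has finite mass. If \<open>z\<close> lies outside the set of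
  parameter \<open>2 R\<close> and \<open>r \<ge> 1/2\<close>, then \<open>r z\<close> lies outside the set of parameter \<open>R\<close>; by the
  weight bound and the substitution, the outer part of the integral is then at most a
  constant times the tail of \<open>\<integral> \<bar>g\<bar>\<^sup>p W\<close>, which is small for large \<open>R\<close>.
\<close>

section \<open>Dilation of Lebesgue integrals\<close>

lemma nn_integral_lebesgue_scaleR:
  fixes F :: "'a::euclidean_space \<Rightarrow> ennreal"
  assumes F: "F \<in> borel_measurable lebesgue" and c: "c > 0"
  shows "(\<integral>\<^sup>+x. F (c *\<^sub>R x) \<partial>lebesgue) = ennreal (1 / c ^ DIM('a)) * (\<integral>\<^sup>+x. F x \<partial>lebesgue)"
proof -
  have T: "(\<lambda>x::'a. c *\<^sub>R x) = (\<lambda>x. 0 + (\<Sum>j\<in>Basis. (c * (x \<bullet> j)) *\<^sub>R j))"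
    unfolding scaleR_scaleR[symmetric] scaleR_sum_right[symmetric] euclidean_representation by simp
  have m: "(\<lambda>x::'a. c *\<^sub>R x) \<in> lebesgue \<rightarrow>\<^sub>M lebesgue"
    unfolding T using c by (intro lebesgue_affine_measurable) auto
  have "lebesgue = density (distr lebesgue lebesgue (\<lambda>x::'a. c *\<^sub>R x)) (\<lambda>_. ennreal (c ^ DIM('a)))"
    unfolding T using lebesgue_affine_euclidean[where c="\<lambda>_::'a. c" and t=0] c
    by (simp add: prod_constant)
  then have "(\<integral>\<^sup>+x. F x \<partial>lebesgue)
      = (\<integral>\<^sup>+x. F x \<partial>density (distr lebesgue lebesgue (\<lambda>x::'a. c *\<^sub>R x)) (\<lambda>_. ennreal (c ^ DIM('a))))"
    by simp
  also have "\<dots> = ennreal (c ^ DIM('a)) * (\<integral>\<^sup>+x. F (c *\<^sub>R x) \<partial>lebesgue)"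
    using F m by (simp add: nn_integral_density nn_integral_distr nn_integral_cmult)
  finally have "ennreal (1 / c ^ DIM('a)) * (\<integral>\<^sup>+x. F x \<partial>lebesgue)
      = ennreal (1 / c ^ DIM('a)) * ennreal (c ^ DIM('a)) * (\<integral>\<^sup>+x. F (c *\<^sub>R x) \<partial>lebesgue)"
    by (simp add: mult.assoc)
  also have "ennreal (1 / c ^ DIM('a)) * ennreal (c ^ DIM('a)) = 1"
    using c by (simp flip: ennreal_mult'')
  finally show ?thesis by simp
qed

section \<open>A compact exhaustion of the half-plane\<close>

lemma sets_upper_half_plane [measurable]: "upper_half_plane \<in> sets borel"
  unfolding upper_half_plane_def by measurable

definition half_plane_box :: "real \<Rightarrow> complex set" where
  "half_plane_box R = {z. 1 / R \<le> Im z \<and> cmod z \<le> R}"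

lemma half_plane_box_subset: "R > 0 \<Longrightarrow> half_plane_box R \<subseteq> upper_half_plane"
proof -
  assume "R > 0"
  then have "0 < 1 / R" by simp
  then show ?thesis by (auto simp: half_plane_box_def upper_half_plane_def simp del: zero_less_divide_1_iff)
qed

lemma compact_half_plane_box: "compact (half_plane_box R)"
proof -
  have "half_plane_box R = {z. 1 / R \<le> Im z} \<inter> cball 0 R"
    by (auto simp: half_plane_box_def)
  moreover have "closed {z. 1 / R \<le> Im z}"
    by (simp add: closed_halfspace_Im_ge)
  ultimately show ?thesis by (simp add: closed_Int_compact)
qed

lemma sets_half_plane_box [measurable]: "half_plane_box R \<in> sets borel"
  by (simp add: borel_compact compact_half_plane_box)

lemma half_plane_box_exhausts:
  assumes "z \<in> upper_half_plane"
  shows "eventually (\<lambda>n. z \<in> half_plane_box (real n)) sequentially"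
proof -
  have y: "Im z > 0" using assms by (simp add: upper_half_plane_def)
  have "eventually (\<lambda>n. real n \<ge> max (cmod z) (1 / Im z)) sequentially"
    using filterlim_real_sequentially unfolding filterlim_at_top by blast
  then show ?thesis
  proof eventually_elim
    case (elim n)
    then have n: "1 / Im z \<le> real n" "cmod z \<le> real n" by auto
    have pos: "0 < 1 / Im z" using y by simp
    have "1 / real n \<le> 1 / (1 / Im z)"
      using n(1) zero_le_one mult_pos_pos[OF less_le_trans[OF pos n(1)] pos] by (rule divide_left_mono)
    then show ?case using n(2) by (simp add: half_plane_box_def)
  qed
qed

lemma scale_mem_upper_half_plane:
  "r > 0 \<Longrightarrow> of_real r * z \<in> upper_half_plane \<longleftrightarrow> z \<in> upper_half_plane"
  by (simp add: upper_half_plane_def zero_less_mult_iff)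

text \<open>
  A dilation by a factor at least \<open>1/2\<close> moves both bounds of a box by at most a factor two.
  This keeps the dilated tail of an integral inside a fixed tail.
\<close>

lemma scale_notin_half_plane_box:
  assumes "R > 0" "1/2 \<le> r" "r \<le> 1" "z \<notin> half_plane_box (2 * R)" "z \<in> upper_half_plane"
  shows "of_real r * z \<notin> half_plane_box R"
proof
  assume a: "of_real r * z \<in> half_plane_box R"
  have y: "Im z > 0" using assms by (simp add: upper_half_plane_def)
  have "1 / R \<le> r * Im z" "r * cmod z \<le> R" using a assms
    by (auto simp: half_plane_box_def norm_mult)
  moreover have "r * Im z \<le> 1 * Im z" using assms y by (intro mult_right_mono) auto
  moreover have "(1/2) * cmod z \<le> r * cmod z" using assms by (intro mult_right_mono) auto
  ultimately have "1 / R \<le> Im z" "cmod z \<le> 2 * R" by auto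
  moreover have "1 / (2 * R) \<le> 1 / R" using assms by (simp add: field_simps)
  ultimately have "z \<in> half_plane_box (2 * R)"
    unfolding half_plane_box_def by auto
  then show False using assms by simp
qed

section \<open>Convergence of dilations in weighted power norms\<close>

lemma weighted_power_measurable:
  fixes W :: "complex \<Rightarrow> real" and h :: "complex \<Rightarrow> complex"
  assumes "continuous_on upper_half_plane h"
    and W: "(\<lambda>z. indicator upper_half_plane z * W z) \<in> borel_measurable lebesgue"
  shows "(\<lambda>z. ennreal (cmod (h z) powr p * W z) * indicator upper_half_plane z)
           \<in> borel_measurable lebesgue"
proof -
  have "(\<lambda>z. indicator upper_half_plane z *\<^sub>R h z) \<in> borel_measurable borel"
    using assms(1) by (intro borel_measurable_continuous_on_indicator) auto
  then have [measurable]: "(\<lambda>z. indicator upper_half_plane z *\<^sub>R h z) \<in> borel_measurable lebesgue"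
    by (simp add: borel_measurable_if measurable_completion)
  note W [measurable]
  have "(\<lambda>z. ennreal (cmod (indicator upper_half_plane z *\<^sub>R h z) powr p
               * (indicator upper_half_plane z * W z))) \<in> borel_measurable lebesgue"
    by measurable
  also have "(\<lambda>z. ennreal (cmod (indicator upper_half_plane z *\<^sub>R h z) powr p
               * (indicator upper_half_plane z * W z)))
      = (\<lambda>z. ennreal (cmod (h z) powr p * W z) * indicator upper_half_plane z)"
    by (auto simp: fun_eq_iff indicator_def)
  finally show ?thesis .
qed

lemma cmod_diff_powr_le:
  assumes "p \<ge> 0"
  shows "cmod (a - b) powr p \<le> 2 powr p * (cmod a powr p + cmod b powr p)"
proof -
  have "cmod (a - b) \<le> 2 * max (cmod a) (cmod b)"
    using norm_triangle_ineq4[of a b] by (auto simp: max_def)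
  then have "cmod (a - b) powr p \<le> (2 * max (cmod a) (cmod b)) powr p"
    using assms by (intro powr_mono2) auto
  also have "\<dots> = 2 powr p * (max (cmod a) (cmod b)) powr p"
    by (simp add: powr_mult max_def)
  also have "\<dots> \<le> 2 powr p * (cmod a powr p + cmod b powr p)"
    by (intro mult_left_mono) (auto simp: max_def)
  finally show ?thesis .
qed

text \<open>
  The expression is jointly continuous in \<open>(r, z)\<close> on the compact set
  \<open>{1/2..1} \<times> K\<close>, hence uniformly continuous there; compare \<open>(r, z)\<close> with \<open>(1, z)\<close>.
\<close>

lemma dilation_uniform_on_compact:
  assumes g: "continuous_on upper_half_plane g" and K: "compact K" "K \<subseteq> upper_half_plane"
    and "\<delta> > 0"
  shows "eventually (\<lambda>r. \<forall>z\<in>K. cmod (of_real r * g (of_real r * z) - g z) < \<delta>) (at_left (1::real))"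
proof -
  let ?S = "{1/2..1::real} \<times> K"
  have S: "compact ?S" using K by (intro compact_Times) auto
  have "continuous_on ?S (\<lambda>x. of_real (fst x) * g (of_real (fst x) * snd x))"
    using K by (intro continuous_intros continuous_on_compose2[OF g])
      (auto simp: subset_iff scale_mem_upper_half_plane)
  then have "uniformly_continuous_on ?S (\<lambda>x. of_real (fst x) * g (of_real (fst x) * snd x))"
    using S compact_uniformly_continuous by blast
  then obtain d where d: "d > 0"
    "\<And>x y. x \<in> ?S \<Longrightarrow> y \<in> ?S \<Longrightarrow> dist y x < d \<Longrightarrow>
       dist (of_real (fst y) * g (of_real (fst y) * snd y)) (of_real (fst x) * g (of_real (fst x) * snd x)) < \<delta>"
    unfolding uniformly_continuous_on_def using \<open>\<delta> > 0\<close> by meson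
  have "eventually (\<lambda>r. r \<in> {max (1/2) (1 - d)<..<1}) (at_left (1::real))"
    using d(1) by (intro eventually_at_left_real) auto
  then show ?thesis
  proof eventually_elim
    case (elim r)
    show ?case
    proof
      fix z assume "z \<in> K"
      then show "cmod (of_real r * g (of_real r * z) - g z) < \<delta>"
        using d(2)[of "(1, z)" "(r, z)"] elim by (auto simp: dist_norm norm_Pair)
    qed
  qed
qed

lemma nn_integral_outside_box_tendsto_0:
  assumes G [measurable]: "G \<in> borel_measurable lebesgue"
    and fin: "(\<integral>\<^sup>+z\<in>upper_half_plane. G z \<partial>lebesgue) < \<infinity>"
  shows "(\<lambda>n. \<integral>\<^sup>+z\<in>upper_half_plane - half_plane_box (real n). G z \<partial>lebesgue) \<longlonglongrightarrow> 0"
proof -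
  have [measurable]: "upper_half_plane \<in> sets lebesgue" "half_plane_box R \<in> sets lebesgue" for R
    using sets_upper_half_plane sets_half_plane_box by (auto intro!: sets_completionI_sets)
  have "(\<lambda>n. \<integral>\<^sup>+z\<in>upper_half_plane - half_plane_box (real n). G z \<partial>lebesgue)
      \<longlonglongrightarrow> (\<integral>\<^sup>+z. 0 \<partial>(lebesgue :: complex measure))"
  proof (rule nn_integral_dominated_convergence[where w="\<lambda>z. G z * indicator upper_half_plane z"])
    show "AE z in lebesgue. (\<lambda>n. G z * indicator (upper_half_plane - half_plane_box (real n)) z) \<longlonglongrightarrow> 0"
    proof (rule AE_I2)
      fix z
      have "eventually (\<lambda>n. G z * indicator (upper_half_plane - half_plane_box (real n)) z = 0) sequentially"
      proof (cases "z \<in> upper_half_plane")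
        case True
        from half_plane_box_exhausts[OF this] show ?thesis
          by eventually_elim auto
      qed auto
      then show "(\<lambda>n. G z * indicator (upper_half_plane - half_plane_box (real n)) z) \<longlonglongrightarrow> 0"
        by (rule tendsto_eventually)
    qed
  qed (use fin in \<open>auto simp: indicator_def\<close>)
  then show ?thesis by simp
qed

text \<open>
  The integral is split along a box of parameter \<open>2 n\<close>: inside, uniform convergence meets a
  finite mass; outside, \<open>\<bar>r g (r z) - g z\<bar>\<^sup>p W z\<close> is at most \<open>2\<^sup>p\<close> times the sum of the values of
  \<open>M \<bar>g\<bar>\<^sup>p W\<close> at \<open>r z\<close> and \<open>\<bar>g\<bar>\<^sup>p W\<close> at \<open>z\<close>, and both integrate to a multiple of the tail
  of \<open>\<bar>g\<bar>\<^sup>p W\<close>.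
\<close>

lemma nn_integral_dilation_diff_tendsto_0:
  fixes W :: "complex \<Rightarrow> real" and g :: "complex \<Rightarrow> complex"
  assumes g: "continuous_on upper_half_plane g" and p: "p > 0"
    and W: "(\<lambda>z. indicator upper_half_plane z * W z) \<in> borel_measurable lebesgue"
    and W0: "\<And>z. z \<in> upper_half_plane \<Longrightarrow> W z \<ge> 0"
    and r0: "r0 < 1" and M: "M \<ge> 0"
    and Wr: "\<And>z r. z \<in> upper_half_plane \<Longrightarrow> r0 \<le> r \<Longrightarrow> r < 1 \<Longrightarrow> W z \<le> M * W (of_real r * z)"
    and Wloc: "\<And>R. R > 0 \<Longrightarrow> (\<integral>\<^sup>+z\<in>half_plane_box R. ennreal (W z) \<partial>lebesgue) < \<infinity>"
    and fin: "(\<integral>\<^sup>+z\<in>upper_half_plane. ennreal (cmod (g z) powr p * W z) \<partial>lebesgue) < \<infinity>"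
  shows "((\<lambda>r::real. \<integral>\<^sup>+z\<in>upper_half_plane.
            ennreal (cmod (of_real r * g (of_real r * z) - g z) powr p * W z) \<partial>lebesgue) \<longlongrightarrow> 0) (at_left 1)"
proof -
  let ?U = upper_half_plane and ?B = half_plane_box
  define G where "G z = ennreal (cmod (g z) powr p * W z) * indicator ?U z" for z
  define J where "J r = (\<integral>\<^sup>+z\<in>?U.
      ennreal (cmod (of_real r * g (of_real r * z) - g z) powr p * W z) \<partial>lebesgue)" for r :: real
  have [measurable]: "?U \<in> sets lebesgue" "?B R \<in> sets lebesgue" for R
    using sets_upper_half_plane sets_half_plane_box by (auto intro!: sets_completionI_sets)
  have Gm [measurable]: "G \<in> borel_measurable lebesgue"
    unfolding G_def by (rule weighted_power_measurable[OF g W])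
  define T where "T n = (\<integral>\<^sup>+z\<in>?U - ?B (real n). G z \<partial>lebesgue)" for n :: nat
  have T0: "T \<longlonglongrightarrow> 0"
    unfolding T_def
  proof (rule nn_integral_outside_box_tendsto_0[OF Gm])
    have "(\<integral>\<^sup>+z\<in>?U. G z \<partial>lebesgue) = (\<integral>\<^sup>+z\<in>?U. ennreal (cmod (g z) powr p * W z) \<partial>lebesgue)"
      by (intro nn_integral_cong) (auto simp: G_def indicator_def)
    then show "(\<integral>\<^sup>+z\<in>?U. G z \<partial>lebesgue) < \<infinity>" using fin by simp
  qed
  \<comment> \<open>The summand 1 accounts for the box, \<open>4 * M\<close> for the dilated tail (the Jacobian
      \<open>1 / r\<^sup>2\<close> is at most 4 for \<open>r \<ge> 1/2\<close>), and the last 1 for the tail of \<open>g\<close> itself.\<close>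
  define C where "C = 1 + 2 powr p * (4 * M + 1)"
  have C: "C > 0" using M unfolding C_def by (intro add_pos_nonneg) auto
  have main: "eventually (\<lambda>r. J r \<le> ennreal (C * \<epsilon>)) (at_left 1)" if e: "\<epsilon> > 0" for \<epsilon> :: real
  proof -
    have "eventually (\<lambda>n. T n < ennreal \<epsilon> \<and> n > 0) sequentially"
      using order_tendstoD(2)[OF T0, of "ennreal \<epsilon>"] e eventually_gt_at_top[of 0]
      by (intro eventually_conj) auto
    then obtain n where n: "T n < ennreal \<epsilon>" "n > 0"
      by (auto simp: eventually_sequentially)
    let ?K = "?B (2 * real n)"
    define v where "v = enn2real (\<integral>\<^sup>+z\<in>?K. ennreal (W z) \<partial>lebesgue)"
    have v: "(\<integral>\<^sup>+z\<in>?K. ennreal (W z) \<partial>lebesgue) = ennreal v" "v \<ge> 0"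
      using Wloc[of "2 * real n"] n unfolding v_def by (auto simp: less_top)
    \<comment> \<open>Uniform distance on the box that makes its contribution \<open>\<delta> powr p * v\<close> at most \<open>\<epsilon>\<close>;
        adding 1 to \<open>v\<close> avoids a division by zero.\<close>
    define \<delta> where "\<delta> = (\<epsilon> / (v + 1)) powr (1 / p)"
    have \<delta>: "\<delta> > 0" "\<delta> powr p * v \<le> \<epsilon>"
    proof -
      show "\<delta> > 0" using e v unfolding \<delta>_def by auto
      have "\<delta> powr p = \<epsilon> / (v + 1)" using p e v unfolding \<delta>_def by (simp add: powr_powr)
      then have "\<delta> powr p * v = \<epsilon> * (v / (v + 1))" by simp
      also have "\<dots> \<le> \<epsilon> * 1" using e v by (intro mult_left_mono) auto
      finally show "\<delta> powr p * v \<le> \<epsilon>" by simp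
    qed
    have K: "?K \<subseteq> ?U" using n by (intro half_plane_box_subset) auto
    have ev1: "eventually (\<lambda>r. \<forall>z\<in>?K. cmod (of_real r * g (of_real r * z) - g z) < \<delta>) (at_left 1)"
      using dilation_uniform_on_compact[OF g compact_half_plane_box K \<delta>(1)] .
    have ev2: "eventually (\<lambda>r. r \<in> {max (1/2) r0<..<1}) (at_left (1::real))"
      using r0 by (intro eventually_at_left_real) auto
    from ev1 ev2 show ?thesis
    proof eventually_elim
      case (elim r)
      then have r: "1/2 \<le> r" "r0 \<le> r" "r < 1" "r > 0" by auto
      define H where "H z = G z * indicator (?U - ?B (real n)) z" for z
      have Hm [measurable]: "H \<in> borel_measurable lebesgue" unfolding H_def by measurable
      have HT: "(\<integral>\<^sup>+z. H z \<partial>lebesgue) = T n" by (simp add: H_def T_def)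
      have Hr: "(\<integral>\<^sup>+z. H (r *\<^sub>R z) \<partial>lebesgue) = ennreal (1 / r\<^sup>2) * T n"
        using nn_integral_lebesgue_scaleR[OF Hm \<open>r > 0\<close>] by (simp add: HT)
      have Hrm [measurable]: "(\<lambda>z. H (r *\<^sub>R z)) \<in> borel_measurable lebesgue"
      proof -
        have "(\<lambda>x::complex. r *\<^sub>R x) \<in> lebesgue \<rightarrow>\<^sub>M lebesgue"
          using lebesgue_measurable_scaling by blast
        from measurable_compose[OF this Hm] show ?thesis .
      qed
      have Wm [measurable]: "(\<lambda>z. ennreal (W z) * indicator ?K z) \<in> borel_measurable lebesgue"
      proof -
        have "(\<lambda>z. ennreal (indicator ?U z * W z) * indicator ?K z) \<in> borel_measurable lebesgue"
          using W by measurable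
        also have "(\<lambda>z. ennreal (indicator ?U z * W z) * indicator ?K z)
             = (\<lambda>z. ennreal (W z) * indicator ?K z)"
          using K by (auto simp: fun_eq_iff indicator_def)
        finally show ?thesis .
      qed
      \<comment> \<open>\<open>H\<close> is the tail of the integrand outside the smaller box of parameter \<open>n\<close>; evaluated at
          \<open>r z\<close> it still captures every \<open>z\<close> outside the box of parameter \<open>2 n\<close>.\<close>
      have pt: "ennreal (cmod (of_real r * g (of_real r * z) - g z) powr p * W z) * indicator ?U z
          \<le> ennreal (\<delta> powr p) * (ennreal (W z) * indicator ?K z)
            + (ennreal (2 powr p * M) * H (r *\<^sub>R z) + ennreal (2 powr p) * H z)" for z
      proof (cases "z \<in> ?U")
        case U: True
        show ?thesis
        proof (cases "z \<in> ?K")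
          case True
          then have "cmod (of_real r * g (of_real r * z) - g z) powr p \<le> \<delta> powr p"
            using elim p by (intro powr_mono2) (auto intro: less_imp_le)
          then have "ennreal (cmod (of_real r * g (of_real r * z) - g z) powr p * W z)
              \<le> ennreal (\<delta> powr p) * ennreal (W z)"
            using W0[OF U] by (simp add: mult_right_mono flip: ennreal_mult)
          then show ?thesis using True U by (auto intro: order_trans)
        next
          case False
          have rU: "of_real r * z \<in> ?U" using U r by (simp add: scale_mem_upper_half_plane)
          have n1: "of_real r * z \<notin> ?B (real n)"
            using scale_notin_half_plane_box[of "real n" r z] False U n r by auto
          have n2: "z \<notin> ?B (real n)"
            using scale_notin_half_plane_box[of "real n" 1 z] False U n by auto
          have H1: "H z = ennreal (cmod (g z) powr p * W z)"
            using U n2 by (simp add: H_def G_def)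
          have H2: "H (r *\<^sub>R z) = ennreal (cmod (g (of_real r * z)) powr p * W (of_real r * z))"
            using rU n1 by (simp add: H_def G_def scaleR_conv_of_real)
          have "cmod (of_real r * g (of_real r * z) - g z) powr p * W z
             \<le> 2 powr p * (cmod (of_real r * g (of_real r * z)) powr p + cmod (g z) powr p) * W z"
            using W0[OF U] p by (intro mult_right_mono cmod_diff_powr_le) auto
          also have "\<dots> = 2 powr p * (cmod (of_real r * g (of_real r * z)) powr p * W z)
              + 2 powr p * (cmod (g z) powr p * W z)" by (simp add: algebra_simps)
          also have "cmod (of_real r * g (of_real r * z)) powr p \<le> cmod (g (of_real r * z)) powr p"
            using r p by (intro powr_mono2) (auto simp: norm_mult mult_left_le_one_le)
          then have "cmod (of_real r * g (of_real r * z)) powr p * W z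
              \<le> cmod (g (of_real r * z)) powr p * (M * W (of_real r * z))"
            using Wr[OF U, of r] W0[OF U] r by (intro mult_mono) auto
          then have "2 powr p * (cmod (of_real r * g (of_real r * z)) powr p * W z)
                + 2 powr p * (cmod (g z) powr p * W z)
              \<le> 2 powr p * (cmod (g (of_real r * z)) powr p * (M * W (of_real r * z)))
                + 2 powr p * (cmod (g z) powr p * W z)"
            by (intro add_right_mono mult_left_mono) auto
          finally have le: "cmod (of_real r * g (of_real r * z) - g z) powr p * W z
            \<le> (2 powr p * M) * (cmod (g (of_real r * z)) powr p * W (of_real r * z))
                + 2 powr p * (cmod (g z) powr p * W z)" by (simp add: mult_ac)
          have "ennreal (cmod (of_real r * g (of_real r * z) - g z) powr p * W z)
            \<le> ennreal (2 powr p * M) * H (r *\<^sub>R z) + ennreal (2 powr p) * H z"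
            unfolding H1 H2 using le W0[OF U] W0[OF rU] M
            by (simp flip: ennreal_mult ennreal_plus)
          then show ?thesis using U False by simp
        qed
      qed simp
      have r2: "1 / r\<^sup>2 \<le> 4"
      proof -
        have "(1/2)\<^sup>2 \<le> r\<^sup>2" using r by (intro power_mono) auto
        then show ?thesis using r by (simp add: field_simps power2_eq_square)
      qed
      have "J r \<le> (\<integral>\<^sup>+z. ennreal (\<delta> powr p) * (ennreal (W z) * indicator ?K z)
            + (ennreal (2 powr p * M) * H (r *\<^sub>R z) + ennreal (2 powr p) * H z) \<partial>lebesgue)"
        unfolding J_def by (intro nn_integral_mono pt)
      also have "\<dots> = ennreal (\<delta> powr p) * ennreal v
          + (ennreal (2 powr p * M) * (ennreal (1 / r\<^sup>2) * T n) + ennreal (2 powr p) * T n)"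
        by (simp add: nn_integral_add nn_integral_cmult v(1) Hr HT)
      also have "\<dots> \<le> ennreal \<epsilon>
          + (ennreal (2 powr p * M) * (ennreal 4 * ennreal \<epsilon>) + ennreal (2 powr p) * ennreal \<epsilon>)"
        using n(1) r2 \<delta>(2) v(2)
        by (intro add_mono mult_left_mono mult_mono ennreal_leI) (auto simp flip: ennreal_mult intro: ennreal_leI)
      also have "\<dots> = ennreal (C * \<epsilon>)"
        using e M unfolding C_def
        by (simp add: algebra_simps flip: ennreal_mult ennreal_plus ennreal_numeral)
      finally show ?case .
    qed
  qed
  have "(J \<longlongrightarrow> 0) (at_left 1)"
  proof (rule order_tendstoI)
    fix a :: ennreal assume "0 < a"
    then obtain b' where b': "0 < b'" "b' < a" using dense by blast
    then have "b' \<noteq> \<infinity>" by auto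
    with b' obtain b where b: "0 < b" "ennreal b < a"
      by (cases b') (auto simp: ennreal_less_zero_iff)
    from main[of "b / C"] show "eventually (\<lambda>r. J r < a) (at_left 1)"
      using b C by (auto elim!: eventually_mono intro: order_le_less_trans)
  qed simp
  then show ?thesis unfolding J_def .
qed

section \<open>Wirtinger derivatives of a dilatation\<close>

lemma Cn_on_Suc_partials_continuous:
  assumes "Cn_on (Suc n) S f"
  shows "continuous_on S (partial_x f)" "continuous_on S (partial_y f)"
  using assms by (cases n; auto)+

lemma partial_x_dilatation_diff:
  assumes "(\<lambda>t. f (Complex t (Im z))) differentiable (at (Re z))"
    and "(\<lambda>t. f (Complex t (Im (of_real r * z)))) differentiable (at (Re (of_real r * z)))"
  shows "partial_x (\<lambda>z. dilatation r f z - f z) z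
           = of_real r * partial_x f (of_real r * z) - partial_x f z"
proof -
  have 1: "((\<lambda>t. f (Complex t (Im z))) has_vector_derivative partial_x f z) (at (Re z))"
    using assms(1) unfolding partial_x_def by (simp add: vector_derivative_works)
  have 2: "((\<lambda>t. f (Complex t (r * Im z))) has_vector_derivative partial_x f (of_real r * z)) (at (r * Re z))"
    using assms(2) unfolding partial_x_def by (simp add: vector_derivative_works)
  have "((\<lambda>t. r * t) has_vector_derivative r) (at (Re z))"
    by (auto intro!: derivative_eq_intros)
  from vector_diff_chain_at[OF this 2]
  have "((\<lambda>t. dilatation r f (Complex t (Im z))) has_vector_derivative of_real r * partial_x f (of_real r * z)) (at (Re z))"
    by (simp add: o_def dilatation_def complex_of_real_mult_Complex scaleR_conv_of_real)
  from has_vector_derivative_diff[OF this 1] show ?thesis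
    unfolding partial_x_def[of "\<lambda>z. dilatation r f z - f z"] by (rule vector_derivative_at)
qed

lemma partial_y_dilatation_diff:
  assumes "(\<lambda>t. f (Complex (Re z) t)) differentiable (at (Im z))"
    and "(\<lambda>t. f (Complex (Re (of_real r * z)) t)) differentiable (at (Im (of_real r * z)))"
  shows "partial_y (\<lambda>z. dilatation r f z - f z) z
           = of_real r * partial_y f (of_real r * z) - partial_y f z"
proof -
  have 1: "((\<lambda>t. f (Complex (Re z) t)) has_vector_derivative partial_y f z) (at (Im z))"
    using assms(1) unfolding partial_y_def by (simp add: vector_derivative_works)
  have 2: "((\<lambda>t. f (Complex (r * Re z) t)) has_vector_derivative partial_y f (of_real r * z)) (at (r * Im z))"
    using assms(2) unfolding partial_y_def by (simp add: vector_derivative_works)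
  have "((\<lambda>t. r * t) has_vector_derivative r) (at (Im z))"
    by (auto intro!: derivative_eq_intros)
  from vector_diff_chain_at[OF this 2]
  have "((\<lambda>t. dilatation r f (Complex (Re z) t)) has_vector_derivative of_real r * partial_y f (of_real r * z)) (at (Im z))"
    by (simp add: o_def dilatation_def complex_of_real_mult_Complex scaleR_conv_of_real)
  from has_vector_derivative_diff[OF this 1] show ?thesis
    unfolding partial_y_def[of "\<lambda>z. dilatation r f z - f z"] by (rule vector_derivative_at)
qed

lemma wirtinger_dilatation_diff:
  assumes f: "Cn_on (Suc n) upper_half_plane f" and r: "r > 0" and z: "z \<in> upper_half_plane"
  shows "d_z (\<lambda>z. dilatation r f z - f z) z = of_real r * d_z f (of_real r * z) - d_z f z"
    and "d_zbar (\<lambda>z. dilatation r f z - f z) z = of_real r * d_zbar f (of_real r * z) - d_zbar f z"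
proof -
  have rz: "of_real r * z \<in> upper_half_plane" using r z by (simp add: scale_mem_upper_half_plane)
  have "partial_x (\<lambda>z. dilatation r f z - f z) z
           = of_real r * partial_x f (of_real r * z) - partial_x f z"
    using f z rz by (intro partial_x_dilatation_diff) (simp_all del: times_complex.sel)
  moreover have "partial_y (\<lambda>z. dilatation r f z - f z) z
           = of_real r * partial_y f (of_real r * z) - partial_y f z"
    using f z rz by (intro partial_y_dilatation_diff) (simp_all del: times_complex.sel)
  ultimately show
    "d_z (\<lambda>z. dilatation r f z - f z) z = of_real r * d_z f (of_real r * z) - d_z f z"
    "d_zbar (\<lambda>z. dilatation r f z - f z) z = of_real r * d_zbar f (of_real r * z) - d_zbar f z"
    unfolding d_z_def d_zbar_def by (simp_all add: diff_divide_distrib add_divide_distrib ring_distribs)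
qed

section \<open>The Besov weight\<close>

definition besov_weight :: "real \<Rightarrow> real \<Rightarrow> (complex \<Rightarrow> real) \<Rightarrow> complex \<Rightarrow> real" where
  "besov_weight s \<beta> w z = w z * Im z powr s * exp (- \<beta> * (cmod z)\<^sup>2)"

lemma besov_weight_nonneg:
  "is_weight w \<Longrightarrow> z \<in> upper_half_plane \<Longrightarrow> besov_weight s \<beta> w z \<ge> 0"
  unfolding besov_weight_def is_weight_def
  by (intro mult_nonneg_nonneg) (auto intro: less_imp_le)

lemma besov_weight_measurable:
  assumes "is_weight w"
  shows "(\<lambda>z. indicator upper_half_plane z * besov_weight s \<beta> w z) \<in> borel_measurable lebesgue"
proof -
  have w [measurable]: "(\<lambda>z. indicator upper_half_plane z *\<^sub>R w z) \<in> borel_measurable lebesgue"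
    using assms by (auto simp: is_weight_def set_integrable_def dest: borel_measurable_integrable)
  have "(\<lambda>z. Im z powr s * exp (- \<beta> * (cmod z)\<^sup>2)) \<in> borel_measurable borel"
    by measurable
  then have [measurable]: "(\<lambda>z. Im z powr s * exp (- \<beta> * (cmod z)\<^sup>2)) \<in> borel_measurable lebesgue"
    by (simp add: measurable_completion)
  have "(\<lambda>z. (indicator upper_half_plane z *\<^sub>R w z) * (Im z powr s * exp (- \<beta> * (cmod z)\<^sup>2)))
          \<in> borel_measurable lebesgue"
    by measurable
  then show ?thesis by (simp add: besov_weight_def mult_ac)
qed

text \<open>
  On a box the factors multiplying the integrable \<open>w\<close> are bounded, by \<open>R powr s\<close> and 1.
\<close>

lemma besov_weight_locally_integrable:
  assumes w: "is_weight w" and s: "s \<ge> 0" and \<beta>: "\<beta> \<ge> 0" and R: "R > 0"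
  shows "(\<integral>\<^sup>+z\<in>half_plane_box R. ennreal (besov_weight s \<beta> w z) \<partial>lebesgue) < \<infinity>"
proof -
  have i: "integrable lebesgue (\<lambda>z. indicator upper_half_plane z *\<^sub>R w z)"
    using w by (simp add: is_weight_def set_integrable_def)
  then have m [measurable]: "(\<lambda>z. indicator upper_half_plane z *\<^sub>R w z) \<in> borel_measurable lebesgue"
    by (rule borel_measurable_integrable)
  have "(\<integral>\<^sup>+z\<in>half_plane_box R. ennreal (besov_weight s \<beta> w z) \<partial>lebesgue)
      \<le> (\<integral>\<^sup>+z. ennreal (R powr s) * ennreal (norm (indicator upper_half_plane z *\<^sub>R w z)) \<partial>lebesgue)"
  proof (rule nn_integral_mono)
    fix z
    show "ennreal (besov_weight s \<beta> w z) * indicator (half_plane_box R) z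
        \<le> ennreal (R powr s) * ennreal (norm (indicator upper_half_plane z *\<^sub>R w z))"
    proof (cases "z \<in> half_plane_box R")
      case True
      then have U: "z \<in> upper_half_plane" using half_plane_box_subset[OF R] by auto
      then have y: "Im z > 0" and w0: "w z > 0" using w by (auto simp: upper_half_plane_def is_weight_def)
      have "Im z \<le> R" using True abs_Im_le_cmod[of z] by (auto simp: half_plane_box_def)
      then have "Im z powr s \<le> R powr s" using y s by (intro powr_mono2) auto
      moreover have "exp (- \<beta> * (cmod z)\<^sup>2) \<le> 1" using \<beta> by simp
      ultimately have "w z * Im z powr s * exp (- \<beta> * (cmod z)\<^sup>2) \<le> w z * R powr s * 1"
        using w0 by (intro mult_mono) auto
      then show ?thesis using True U w0
        by (simp add: besov_weight_def mult_ac ennreal_leI flip: ennreal_mult)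
    qed simp
  qed
  also have "\<dots> = ennreal (R powr s) * (\<integral>\<^sup>+z. ennreal (norm (indicator upper_half_plane z *\<^sub>R w z)) \<partial>lebesgue)"
    by (rule nn_integral_cmult) measurable
  also have "\<dots> < \<infinity>"
    using i by (simp add: integrable_iff_bounded ennreal_mult_less_top del: norm_scaleR real_norm_def)
  finally show ?thesis .
qed

text \<open>
  The hypothesis on \<open>w\<close> is used at the point \<open>r z\<close>, where it compares \<open>w z\<close> with
  \<open>w (r z)\<close>. The powers of \<open>1 / r\<close> that it and the factor \<open>Im z powr s\<close> produce are replaced
  by powers of \<open>1 / r0\<close>, which makes the constant independent of \<open>r\<close>.
\<close>

lemma besov_weight_dilation_bound:
  assumes w: "is_weight w" and s: "s \<ge> 0" and \<beta>: "\<beta> \<ge> 0" and C: "C > 0"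
    and r0: "r0 > 0" and r: "r0 \<le> r" "r < 1" and z: "z \<in> upper_half_plane"
    and dil: "\<And>z. z \<in> upper_half_plane \<Longrightarrow> r ^ k * w (z / of_real r) \<le> C * w z"
  shows "besov_weight s \<beta> w z
    \<le> (C / r0 ^ k * (1 / r0) powr s) * besov_weight s \<beta> w (of_real r * z)"
proof -
  have r': "r > 0" using r0 r by simp
  have rz: "of_real r * z \<in> upper_half_plane" using z r' by (simp add: scale_mem_upper_half_plane)
  have y: "Im z > 0" using z by (simp add: upper_half_plane_def)
  have w0: "w z > 0" "w (of_real r * z) > 0" using w z rz by (auto simp: is_weight_def)
  have "r ^ k * w z \<le> C * w (of_real r * z)" using dil[OF rz] r' by simp
  moreover have "r0 ^ k * w z \<le> r ^ k * w z" using r r0 w0 by (intro mult_right_mono power_mono) auto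
  ultimately have a: "w z \<le> C / r0 ^ k * w (of_real r * z)"
    using r0 by (simp add: field_simps)
  have "Im z * r0 \<le> Im z * r" using r y by (intro mult_left_mono) auto
  then have "Im z \<le> 1 / r0 * Im (of_real r * z)" using r0 by (simp add: field_simps)
  then have "Im z powr s \<le> (1 / r0 * Im (of_real r * z)) powr s" using y s by (intro powr_mono2) auto
  then have b: "Im z powr s \<le> (1 / r0) powr s * Im (of_real r * z) powr s"
    by (simp only: powr_mult)
  have "cmod (of_real r * z) \<le> cmod z" using r r' by (simp add: norm_mult mult_left_le_one_le)
  then have c: "exp (- \<beta> * (cmod z)\<^sup>2) \<le> exp (- \<beta> * (cmod (of_real r * z))\<^sup>2)"
    using \<beta> by (simp add: mult_left_mono power_mono)
  have "besov_weight s \<beta> w z \<le> (C / r0 ^ k * w (of_real r * z))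
      * ((1 / r0) powr s * Im (of_real r * z) powr s) * exp (- \<beta> * (cmod (of_real r * z))\<^sup>2)"
    unfolding besov_weight_def using a b c w0 C r0 by (intro mult_mono) auto
  then show ?thesis by (simp add: besov_weight_def mult_ac)
qed

section \<open>Convergence in the Besov norm\<close>

lemma besov_norm_pow_split:
  assumes "is_weight w" "continuous_on upper_half_plane u" "continuous_on upper_half_plane v"
    and "\<And>z. z \<in> upper_half_plane \<Longrightarrow> d_z f z = u z" "\<And>z. z \<in> upper_half_plane \<Longrightarrow> d_zbar f z = v z"
  shows "besov_norm_pow \<alpha> \<beta> p w f = ennreal (cmod (f \<i>) powr p)
    + ((\<integral>\<^sup>+z\<in>upper_half_plane. ennreal (cmod (u z) powr p * besov_weight (\<alpha> + p - 2) \<beta> w z) \<partial>lebesgue)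
     + (\<integral>\<^sup>+z\<in>upper_half_plane. ennreal (cmod (v z) powr p * besov_weight (\<alpha> + p - 2) \<beta> w z) \<partial>lebesgue))"
proof -
  let ?W = "besov_weight (\<alpha> + p - 2) \<beta> w"
  have "ennreal ((cmod (d_z f z) powr p + cmod (d_zbar f z) powr p)
           * w z * Im z powr (\<alpha> + p - 2) * exp (- \<beta> * (cmod z)\<^sup>2)) * indicator upper_half_plane z
      = ennreal (cmod (u z) powr p * ?W z) * indicator upper_half_plane z
        + ennreal (cmod (v z) powr p * ?W z) * indicator upper_half_plane z" for z
  proof (cases "z \<in> upper_half_plane")
    case True
    have "(cmod (u z) powr p + cmod (v z) powr p) * w z * Im z powr (\<alpha> + p - 2) * exp (- \<beta> * (cmod z)\<^sup>2)
       = cmod (u z) powr p * ?W z + cmod (v z) powr p * ?W z"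
      by (simp add: besov_weight_def algebra_simps)
    then show ?thesis using True assms besov_weight_nonneg[OF assms(1) True]
      by (simp flip: ennreal_plus)
  qed simp
  then show ?thesis unfolding besov_norm_pow_def
    using assms(2,3) besov_weight_measurable[OF assms(1)]
    by (simp add: nn_integral_add weighted_power_measurable)
qed

lemma besov_norm_tendsto_0:
  assumes lim: "((\<lambda>r. besov_norm_pow \<alpha> \<beta> p w (h r)) \<longlongrightarrow> 0) F" and p: "p > 0"
  shows "((\<lambda>r. besov_norm \<alpha> \<beta> p w (h r)) \<longlongrightarrow> 0) F"
proof -
  have "((\<lambda>r. enn2real (besov_norm_pow \<alpha> \<beta> p w (h r))) \<longlongrightarrow> 0) F"
    using lim by (intro tendsto_enn2real) auto
  then have "((\<lambda>r. enn2real (besov_norm_pow \<alpha> \<beta> p w (h r)) powr (1 / p)) \<longlongrightarrow> 0) F"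
    using p by (intro tendsto_zero_powrI[where b="1 / p"]) auto
  then have "((\<lambda>r. ennreal (enn2real (besov_norm_pow \<alpha> \<beta> p w (h r)) powr (1 / p))) \<longlongrightarrow> ennreal 0) F"
    by (rule tendsto_ennrealI)
  moreover have "eventually (\<lambda>r. besov_norm_pow \<alpha> \<beta> p w (h r) < \<infinity>) F"
    using order_tendstoD(2)[OF lim, of \<infinity>] by simp
  then have "eventually (\<lambda>r. ennreal (enn2real (besov_norm_pow \<alpha> \<beta> p w (h r)) powr (1 / p))
      = besov_norm \<alpha> \<beta> p w (h r)) F"
    by eventually_elim (auto simp: besov_norm_def)
  ultimately show ?thesis by (simp add: tendsto_cong)
qed

theorem theorem3p3:
  fixes q :: nat and \<alpha> \<beta> p :: real
    and w :: "complex \<Rightarrow> real" and f :: "complex \<Rightarrow> complex"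
  assumes "q \<ge> 1" and "\<alpha> \<ge> 0" and "\<beta> \<ge> 0" and "p \<ge> 2"
    and "is_weight w"
    and "\<exists>C>0. \<exists>k::nat. \<exists>r0\<in>{0<..<1}. \<forall>z\<in>upper_half_plane. \<forall>r::real.
           r0 \<le> r \<and> r < 1 \<longrightarrow> r ^ k * w (z / of_real r) \<le> C * w z"
    and "f \<in> besov_space q \<alpha> \<beta> p w"
  shows "((\<lambda>r. besov_norm \<alpha> \<beta> p w (\<lambda>z. dilatation r f z - f z)) \<longlongrightarrow> 0) (at_left 1)"
proof (rule besov_norm_tendsto_0)
  show "p > 0" using \<open>p \<ge> 2\<close> by simp
  let ?U = upper_half_plane
  let ?W = "besov_weight (\<alpha> + p - 2) \<beta> w"
  obtain C k r0 where C: "C > 0" and r0: "r0 > 0" "r0 < 1"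
    and dil: "\<And>z r. z \<in> ?U \<Longrightarrow> r0 \<le> r \<Longrightarrow> r < 1 \<Longrightarrow> r ^ k * w (z / of_real r) \<le> C * w z"
    using assms(6) by (elim exE conjE bexE) (metis greaterThanLessThan_iff)
  have s: "\<alpha> + p - 2 \<ge> 0" using assms by simp
  obtain n where q: "q = Suc n" using \<open>q \<ge> 1\<close> by (cases q) auto
  have Cn: "Cn_on (Suc n) ?U f" and fin: "besov_norm_pow \<alpha> \<beta> p w f < \<infinity>"
    using assms(7) by (auto simp: besov_space_def q_analytic_def q)
  note px = Cn_on_Suc_partials_continuous[OF Cn]
  have cz: "continuous_on ?U (d_z f)" "continuous_on ?U (d_zbar f)"
    unfolding d_z_def d_zbar_def by (intro continuous_intros px; simp)+
  have cf: "continuous_on ?U f" using Cn by simp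
  define I where "I g r = (\<integral>\<^sup>+z\<in>?U. ennreal (cmod (of_real r * g (of_real r * z) - g z) powr p * ?W z) \<partial>lebesgue)"
    for g :: "complex \<Rightarrow> complex" and r :: real
  have lim: "(I g \<longlongrightarrow> 0) (at_left 1)"
    if "continuous_on ?U g" "(\<integral>\<^sup>+z\<in>?U. ennreal (cmod (g z) powr p * ?W z) \<partial>lebesgue) < \<infinity>" for g
    unfolding I_def
  proof (rule nn_integral_dilation_diff_tendsto_0[where ?r0.0=r0 and M="C / r0 ^ k * (1 / r0) powr (\<alpha> + p - 2)"])
    show "?W z \<le> (C / r0 ^ k * (1 / r0) powr (\<alpha> + p - 2)) * ?W (of_real r * z)"
      if "z \<in> ?U" "r0 \<le> r" "r < 1" for z r
      using that assms s C r0 dil by (intro besov_weight_dilation_bound) auto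
  qed (use that assms s C r0 besov_weight_measurable besov_weight_nonneg
         besov_weight_locally_integrable in auto)
  have fin2: "(\<integral>\<^sup>+z\<in>?U. ennreal (cmod (d_z f z) powr p * ?W z) \<partial>lebesgue) < \<infinity>"
     "(\<integral>\<^sup>+z\<in>?U. ennreal (cmod (d_zbar f z) powr p * ?W z) \<partial>lebesgue) < \<infinity>"
    using fin besov_norm_pow_split[OF assms(5) cz, of f \<alpha> \<beta> p] by (auto simp: less_top)
  have "((\<lambda>r. ennreal (cmod (dilatation r f \<i> - f \<i>) powr p)) \<longlongrightarrow> ennreal 0) (at_left 1)"
  proof (intro tendsto_ennrealI tendsto_zero_powrI)
    have "isCont f \<i>"
      using cf by (rule continuous_on_interior)
        (simp add: upper_half_plane_def interior_open open_halfspace_Im_gt)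
    moreover have "((\<lambda>r::real. of_real r * \<i>) \<longlongrightarrow> of_real 1 * \<i>) (at_left 1)"
      by (intro tendsto_intros)
    ultimately have "((\<lambda>r::real. f (of_real r * \<i>)) \<longlongrightarrow> f \<i>) (at_left 1)"
      by (metis isCont_tendsto_compose mult_1 of_real_1)
    then show "((\<lambda>r. cmod (dilatation r f \<i> - f \<i>)) \<longlongrightarrow> 0) (at_left 1)"
      unfolding dilatation_def by (simp add: LIM_zero tendsto_norm_zero)
  qed (use assms in auto)
  then have "((\<lambda>r. ennreal (cmod (dilatation r f \<i> - f \<i>) powr p) + (I (d_z f) r + I (d_zbar f) r))
      \<longlongrightarrow> 0 + (0 + 0)) (at_left 1)"
    using lim[OF cz(1) fin2(1)] lim[OF cz(2) fin2(2)] by (intro tendsto_add) auto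
  moreover have "eventually (\<lambda>r. besov_norm_pow \<alpha> \<beta> p w (\<lambda>z. dilatation r f z - f z)
     = ennreal (cmod (dilatation r f \<i> - f \<i>) powr p) + (I (d_z f) r + I (d_zbar f) r)) (at_left 1)"
  proof -
    have "eventually (\<lambda>r. r \<in> {0<..<1}) (at_left (1::real))"
      by (intro eventually_at_left_real) auto
    then show ?thesis
    proof eventually_elim
      case (elim r)
      then have r: "r > 0" by simp
      have "continuous_on ?U (\<lambda>z. of_real r * g (of_real r * z) - g z)"
        if "continuous_on ?U g" for g :: "complex \<Rightarrow> complex"
        using that r by (intro continuous_intros continuous_on_compose2[OF that])
          (auto simp: scale_mem_upper_half_plane)
      then show ?case unfolding I_def
        using wirtinger_dilatation_diff[OF Cn r] cz assms(5)
        by (intro besov_norm_pow_split) auto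
    qed
  qed
  ultimately show "((\<lambda>r. besov_norm_pow \<alpha> \<beta> p w (\<lambda>z. dilatation r f z - f z)) \<longlongrightarrow> 0) (at_left 1)"
    by (simp add: tendsto_cong)
qed

end
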